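(* Let $A,B\in\mathbb{R}^{m\times n}$ with $\operatorname{rank}(A)=\operatorname{rank}(B)=n$, let $b\in\mathbb{R}^m$, and let $C\in\mathbb{R}^{n\times n}$ be nonsingular with $A=BC$. Let $x_*\in\mathbb{R}^n$ be the exact solution of the not-normal equations $B^TAx_*=B^Tb$. Let $E_A,E_B\in\mathbb{R}^{m\times n}$, $\epsilon_A\equiv\|E_A\|/\|A\|$ and $\epsilon_B\equiv\|E_B\|/\|B\|$, and let the computed solution $\hat x\in\mathbb{R}^n$ satisfy $$(B+E_B)^T(A+E_A)\hat x=(B+E_B)^Tb.$$ If $\hat x\neq 0$, then $$\frac{\|\hat x-x_*\|}{\|\hat x\|}\leq \kappa(B^TA)\,\nu\left(\epsilon_B\,\frac{\|A\hat x-b\|}{\|A\|\,\|\hat x\|}+(1+\epsilon_B)\,\epsilon_A\right),\qquad \nu\equiv\frac{\|B\|\,\|A\|}{\|B^TA\|}\geq 1.$$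
   Context: $\|\cdot\|$ denotes the Euclidean two-norm (for matrices, the induced spectral norm). For a nonsingular square matrix $M$, $\kappa(M)\equiv\|M\|\,\|M^{-1}\|$. No assumption is made on the ranks of $A+E_A$ and $B+E_B$. *)

theory Defs
  imports "HOL-Analysis.Analysis"
begin

definition spectral_norm :: "real^'n^'m \<Rightarrow> real" where
  "spectral_norm M = onorm (\<lambda>x. M *v x)"

(* Meaningful for invertible M only, since matrix_inv is unspecified otherwise. *)
definition cond_num :: "real^'n^'n \<Rightarrow> real" where
  "cond_num M = spectral_norm M * spectral_norm (matrix_inv M)"

end

theory Submission
  imports Defs
begin

text \<open>Put \<open>r = A x_hat - b\<close>. The exact equations give \<open>B\<^sup>T A (x_hat - x_star) = B\<^sup>T r\<close>, and the
  perturbed ones say that \<open>r + E\<^sub>A x_hat\<close> is annihilated by \<open>(B + E\<^sub>B)\<^sup>T\<close>, so that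
  \<open>B\<^sup>T r = - (E\<^sub>B\<^sup>T r + (B + E\<^sub>B)\<^sup>T E\<^sub>A x_hat)\<close> is small. The relation \<open>A = B C\<close> enters only
  to make \<open>B\<^sup>T A = B\<^sup>T B C\<close> invertible.\<close>

lemma norm_mult_le_spectral_norm: "norm (M *v x) \<le> spectral_norm M * norm x"
  unfolding spectral_norm_def by (rule onorm[OF matrix_vector_mul_bounded_linear])

lemma spectral_norm_nonneg: "0 \<le> spectral_norm M"
  unfolding spectral_norm_def by (rule onorm_pos_le[OF matrix_vector_mul_bounded_linear])

lemma spectral_norm_leI:
  assumes "\<And>x. norm (M *v x) \<le> c * norm x"
  shows "spectral_norm M \<le> c"
  unfolding spectral_norm_def using assms by (rule onorm_le)

lemma spectral_norm_add_le: "spectral_norm (M + N) \<le> spectral_norm M + spectral_norm N"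
  unfolding spectral_norm_def matrix_vector_mult_add_rdistrib
  by (intro onorm_triangle matrix_vector_mul_bounded_linear)

lemma spectral_norm_mult_le: "spectral_norm (M ** N) \<le> spectral_norm M * spectral_norm N"
  unfolding spectral_norm_def
  using onorm_compose[OF matrix_vector_mul_bounded_linear[of M] matrix_vector_mul_bounded_linear[of N]]
  by (simp add: o_def matrix_vector_mul_assoc)

text \<open>For \<open>z = transpose M *v y\<close>, moving the transpose across the inner product
  gives |z|^2 = y . Mz, which Cauchy-Schwarz bounds by |y| |M| |z|. One factor |z| cancels unless it
  is zero, and then nonnegativity suffices.\<close>

lemma spectral_norm_transpose_le:
  fixes M :: "real^'n^'m"
  shows "spectral_norm (transpose M) \<le> spectral_norm M"
proof (rule spectral_norm_leI)
  fix y :: "real^'m"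
  let ?z = "transpose M *v y"
  have "norm ?z * norm ?z = y \<bullet> (M *v ?z)"
    by (metis dot_lmul_matrix norm_eq_sqrt_inner real_sqrt_mult_self abs_of_nonneg inner_ge_zero
        transpose_matrix_vector)
  also have "\<dots> \<le> norm y * norm (M *v ?z)"
    by (rule norm_cauchy_schwarz)
  also have "\<dots> \<le> norm y * (spectral_norm M * norm ?z)"
    by (intro mult_left_mono norm_mult_le_spectral_norm) simp
  finally have "norm ?z * norm ?z \<le> (spectral_norm M * norm y) * norm ?z"
    by (simp add: mult_ac)
  then show "norm ?z \<le> spectral_norm M * norm y"
    by (cases "norm ?z = 0") (auto simp: spectral_norm_nonneg)
qed

lemma spectral_norm_pos_of_inj:
  fixes M :: "real^'n^'m"
  assumes "inj ((*v) M)"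
  shows "0 < spectral_norm M"
proof -
  \<comment> \<open>Index types are nonempty, so \<open>undefined\<close> stands for some index; the
    unit vector there is a nonzero test vector.\<close>
  have "M *v axis undefined 1 \<noteq> 0"
    using assms by (metis axis_eq_0_iff injD matrix_vector_mult_0_right zero_neq_one)
  then show ?thesis
    using norm_mult_le_spectral_norm[of M "axis undefined 1"] norm_axis_1
    by (metis mult.right_neutral order_less_le_trans zero_less_norm_iff)
qed

text \<open>The Gram matrix of \<open>B\<close> has trivial kernel because x . (B^T B x) = |Bx|^2
  and \<open>B\<close> is injective. Being square, it is invertible, and so is its product with
  \<open>C\<close>.\<close>

lemma invertible_transpose_mult_mult:
  fixes B :: "real^'n^'m" and C :: "real^'n^'n"
  assumes "inj ((*v) B)" and "invertible C"
  shows "invertible (transpose B ** (B ** C))"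
proof -
  have "x = 0" if "(transpose B ** B) *v x = 0" for x
  proof -
    have "(B *v x) \<bullet> (B *v x) = x \<bullet> ((transpose B ** B) *v x)"
      by (metis dot_lmul_matrix inner_commute matrix_vector_mul_assoc transpose_matrix_vector)
    then have "B *v x = B *v 0" using that by simp
    then show ?thesis by (rule injD[OF assms(1)])
  qed
  then have "invertible (transpose B ** B)"
    by (simp add: invertible_left_inverse matrix_left_invertible_ker)
  then show ?thesis
    using assms(2) by (simp add: matrix_mul_assoc invertible_mult)
qed

text \<open>Turns a bound on the image \<open>M *v x\<close> into one on \<open>x\<close>; this is
  the source of the second factor of \<open>cond_num\<close>.\<close>

lemma norm_le_matrix_inv:
  fixes M :: "real^'n^'n"
  assumes "invertible M"
  shows "norm x \<le> spectral_norm (matrix_inv M) * norm (M *v x)"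
proof -
  \<comment> \<open>\<open>matrix_inv\<close> is a Hilbert choice, so it acts as an inverse only
    because invertibility supplies a witness.\<close>
  have "x = matrix_inv M *v (M *v x)"
    using assms unfolding invertible_def matrix_inv_def
    by (metis (mono_tags, lifting) matrix_vector_mul_assoc matrix_vector_mul_lid someI_ex)
  then show ?thesis
    using norm_mult_le_spectral_norm by metis
qed

theorem theorem5p2:
  fixes A B E\<^sub>A E\<^sub>B :: "real^'n^'m"
    and b :: "real^'m"
    and C :: "real^'n^'n"
    and x_star x_hat :: "real^'n"
    and \<epsilon>\<^sub>A \<epsilon>\<^sub>B \<nu> :: real
  assumes "rank A = CARD('n)" and "rank B = CARD('n)"
    and "invertible C" and "A = B ** C"
    and "(transpose B ** A) *v x_star = transpose B *v b"
    and "\<epsilon>\<^sub>A = spectral_norm E\<^sub>A / spectral_norm A"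
    and "\<epsilon>\<^sub>B = spectral_norm E\<^sub>B / spectral_norm B"
    and "(transpose (B + E\<^sub>B) ** (A + E\<^sub>A)) *v x_hat = transpose (B + E\<^sub>B) *v b"
    and "\<nu> = spectral_norm B * spectral_norm A / spectral_norm (transpose B ** A)"
  shows "(x_hat \<noteq> 0 \<longrightarrow>
           norm (x_hat - x_star) / norm x_hat
             \<le> cond_num (transpose B ** A) * \<nu> *
                (\<epsilon>\<^sub>B * (norm (A *v x_hat - b) / (spectral_norm A * norm x_hat))
                  + (1 + \<epsilon>\<^sub>B) * \<epsilon>\<^sub>A))
         \<and> \<nu> \<ge> 1"
proof -
  let ?M = "transpose B ** A"
  let ?r = "A *v x_hat - b"
  let ?a = "spectral_norm A" and ?b = "spectral_norm B" and ?m = "spectral_norm ?M"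
  let ?ea = "spectral_norm E\<^sub>A" and ?eb = "spectral_norm E\<^sub>B"
  let ?i = "spectral_norm (matrix_inv ?M)"
  have injA: "inj ((*v) A)" and injB: "inj ((*v) B)"
    using assms(1,2) by (simp_all add: full_rank_injective)
  have inv: "invertible ?M"
    using invertible_transpose_mult_mult[OF injB assms(3)] assms(4) by simp
  then have "inj ((*v) ?M)"
    by (metis invertible_left_inverse matrix_left_invertible_injective)
  then have pos: "0 < ?a" "0 < ?b" "0 < ?m"
    using injA injB by (blast intro: spectral_norm_pos_of_inj)+
  have "?m \<le> ?b * ?a"
    by (rule order_trans[OF spectral_norm_mult_le])
      (intro mult_right_mono spectral_norm_transpose_le spectral_norm_nonneg)
  then have nu: "1 \<le> \<nu>"
    using pos by (simp add: assms(9))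
  have "transpose (B + E\<^sub>B) *v (?r + E\<^sub>A *v x_hat) = 0"
    using assms(8)
    by (simp add: matrix_vector_mul_assoc[symmetric] algebra_simps)
  \<comment> \<open>Only the product with the residual is split. Keeping
    \<open>B + E\<^sub>B\<close> whole in front of \<open>E\<^sub>A *v x_hat\<close> is what later
    produces the factor \<open>1 + \<epsilon>\<^sub>B\<close>.\<close>
  then have "transpose B *v ?r = - (transpose E\<^sub>B *v ?r + transpose (B + E\<^sub>B) *v (E\<^sub>A *v x_hat))"
    by (simp add: transpose_matrix_vector vector_matrix_mult_add_rdistrib algebra_simps)
  moreover have "?M *v (x_hat - x_star) = transpose B *v ?r"
    using assms(5) by (simp add: matrix_vector_mult_diff_distrib matrix_vector_mul_assoc)
  ultimately have "norm (?M *v (x_hat - x_star))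
      = norm (transpose E\<^sub>B *v ?r + transpose (B + E\<^sub>B) *v (E\<^sub>A *v x_hat))"
    by (metis norm_minus_cancel)
  also have "\<dots> \<le> ?eb * norm ?r + (?b + ?eb) * (?ea * norm x_hat)"
  proof (intro norm_triangle_le add_mono)
    show "norm (transpose E\<^sub>B *v ?r) \<le> ?eb * norm ?r"
      by (rule order_trans[OF norm_mult_le_spectral_norm])
        (intro mult_right_mono spectral_norm_transpose_le norm_ge_zero)
    have "spectral_norm (transpose (B + E\<^sub>B)) \<le> ?b + ?eb"
      by (rule order_trans[OF spectral_norm_transpose_le spectral_norm_add_le])
    then show "norm (transpose (B + E\<^sub>B) *v (E\<^sub>A *v x_hat)) \<le> (?b + ?eb) * (?ea * norm x_hat)"
      by (intro order_trans[OF norm_mult_le_spectral_norm] mult_mono norm_mult_le_spectral_norm)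
        (simp_all add: spectral_norm_nonneg)
  qed
  finally have "norm (x_hat - x_star) \<le> ?i * (?eb * norm ?r + (?b + ?eb) * (?ea * norm x_hat))"
    by (rule order_trans[OF norm_le_matrix_inv[OF inv] mult_left_mono[OF _ spectral_norm_nonneg]])
  \<comment> \<open>No loss here: the factor \<open>?m\<close> of \<open>cond_num ?M\<close> cancels
    the denominator of \<open>\<nu>\<close>, leaving \<open>?i * ?b * ?a\<close>. Then
    \<open>?b\<close> and \<open>?a\<close> turn the relative perturbations back into
    \<open>?eb\<close> and \<open>?ea\<close>, and \<open>?a\<close> cancels below the
    residual.\<close>
  moreover have "?i * (?eb * norm ?r + (?b + ?eb) * (?ea * norm x_hat)) / norm x_hat
      = cond_num ?M * \<nu> * (\<epsilon>\<^sub>B * (norm ?r / (?a * norm x_hat)) + (1 + \<epsilon>\<^sub>B) * \<epsilon>\<^sub>A)"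
    if "x_hat \<noteq> 0"
    using that pos by (simp add: cond_num_def assms(6,7,9) field_simps)
  ultimately show ?thesis
    using nu by (metis divide_right_mono norm_ge_zero)
qed

end
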